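(* Let $Q$ and $\mathcal{H}$ be $r$-graphs. For every real $\alpha \ge 1$, $$\eta_{\alpha, Q}(\mathcal{H}) = \lambda_{\alpha, Q}(\mathcal{H}).$$
   Context: $r\ge 2$ is an integer. An $r$-graph is a collection of $r$-subsets (edges) of a finite vertex set. Let $V(Q)=[q]$ and $V(\mathcal{H})=[n]$. $\mathrm{Inj}(Q,\mathcal{H})$ is the set of injective maps $\phi:V(Q)\to V(\mathcal{H})$ with $\phi(e)\in\mathcal{H}$ for every edge $e\in Q$; such a $\phi$ is identified with the tuple $(\phi(1),\ldots,\phi(q))$. $\mathrm{Aut}(Q):=\mathrm{Inj}(Q,Q)$. Let $$P_{Q,\mathcal{H}}(X_1,\ldots,X_n) := \sum_{\phi\in\mathrm{Inj}(Q,\mathcal{H})}\ \prod_{i\in\phi(V(Q))}X_i,\qquad \Delta^{n-1}_{\alpha} := \{(x_1,\ldots,x_n)\in\mathbb{R}^n: |x_1|^{\alpha}+\cdots+|x_n|^{\alpha}=1\},$$ and $\lambda_{\alpha,Q}(\mathcal{H}) := \max\{P_{Q,\mathcal{H}}(\mathbf{x}):\mathbf{x}\in\Delta^{n-1}_{\alpha}\}$. For a discrete random variable $X$ on a finite set $\Omega$, the Shannon entropy is $\mathbb{H}[X] := -\sum_{x\in\Omega}\mathbb{P}(X=x)\log_2\mathbb{P}(X=x)$, with $0\log_2 0=0$. For random variables $X_1,\ldots,X_q$ with values in a common finite set $\Omega$, their mixture $\mu(X_1,\ldots,X_q)$ is (a random variable with) the distribution $\mathbb{P}(\mu(X_1,\ldots,X_q)=v)=\frac1q\sum_{i=1}^q\mathbb{P}(X_i=v)$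 for $v\in\Omega$. A $q$-tuple of random variables $(X_1,\ldots,X_q)$ is a random embedding of $Q$ in $\mathcal{H}$ if (i) $(X_1,\ldots,X_q)$ is always an element of $\mathrm{Inj}(Q,\mathcal{H})$, and (ii) it is symmetric with respect to $\mathrm{Aut}(Q)$, i.e. $(X_1,\ldots,X_q)$ has the same distribution as $(X_{\sigma(1)},\ldots,X_{\sigma(q)})$ for every $\sigma\in\mathrm{Aut}(Q)$. The $(\alpha,Q)$-entropic density of $\mathcal{H}$ is $$\eta_{\alpha,Q}(\mathcal{H}) := \max_{(X_1,\ldots,X_q)} 2^{\,\mathbb{H}[(X_1,\ldots,X_q)]-\frac{q}{\alpha}\mathbb{H}[\mu(X_1,\ldots,X_q)]},$$ the maximum being over all random embeddings of $Q$ in $\mathcal{H}$ (interpreted as $0$ when $\mathrm{Inj}(Q,\mathcal{H})=\emptyset$, so that no random embedding exists). *)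

theory Defs
  imports "HOL-Probability.Probability" "HOL-Real_Asymp.Real_Asymp"
begin

text \<open>
  The vertex sets \<open>V(Q) = [q]\<close> and \<open>V(H) = [n]\<close> are rendered as finite (nonempty) types \<open>'q\<close> and
  \<open>'n\<close>, so \<open>q = CARD('q)\<close> and \<open>n = CARD('n)\<close>, and a hypergraph is given by its set of edges.
\<close>

definition r_graph :: "nat \<Rightarrow> 'v::finite set set \<Rightarrow> bool" where
  "r_graph r E \<longleftrightarrow> (\<forall>e\<in>E. card e = r)"

definition Inj :: "'q::finite set set \<Rightarrow> 'n::finite set set \<Rightarrow> ('q \<Rightarrow> 'n) set" where
  "Inj Q H = {\<phi>. inj \<phi> \<and> (\<forall>e\<in>Q. \<phi> ` e \<in> H)}"

definition Aut :: "'q::finite set set \<Rightarrow> ('q \<Rightarrow> 'q) set" where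
  "Aut Q = Inj Q Q"

definition lagrange_poly ::
    "'q::finite set set \<Rightarrow> 'n::finite set set \<Rightarrow> real ^ 'n \<Rightarrow> real" where
  "lagrange_poly Q H x = (\<Sum>\<phi>\<in>Inj Q H. \<Prod>i\<in>range \<phi>. x $ i)"

definition alpha_sphere :: "real \<Rightarrow> (real ^ 'n::finite) set" where
  "alpha_sphere \<alpha> = {x. (\<Sum>i\<in>UNIV. \<bar>x $ i\<bar> powr \<alpha>) = 1}"

text \<open>
  Maxima are expressed by \<^const>\<open>Greatest\<close>, which denotes the greatest element of a set
  provided that one exists; this is shown in \<open>lagrangian_max_exists\<close> and
  \<open>entropic_max_exists\<close> below.
\<close>

definition lagrangian :: "real \<Rightarrow> 'q::finite set set \<Rightarrow> 'n::finite set set \<Rightarrow> real" where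
  "lagrangian \<alpha> Q H = (GREATEST m. m \<in> lagrange_poly Q H ` alpha_sphere \<alpha>)"

text \<open>
  A random variable enters only through its distribution, a \<^type>\<open>pmf\<close>; a tuple
  \<open>(X\<^sub>1, \<dots>, X\<^sub>q)\<close> is given by its joint distribution \<open>p\<close> on \<open>'q \<Rightarrow> 'n\<close>, and the
  distribution of \<open>X\<^sub>i\<close> is the marginal \<open>map_pmf (\<lambda>\<phi>. \<phi> i) p\<close>.
  Since \<open>0 * y = 0\<close>, the convention \<open>0 log 0 = 0\<close> holds automatically.
\<close>

definition shannon_entropy :: "'a::finite pmf \<Rightarrow> real" where
  "shannon_entropy p = - (\<Sum>x\<in>UNIV. pmf p x * log 2 (pmf p x))"

definition mixture :: "('i::finite \<Rightarrow> 'a pmf) \<Rightarrow> 'a pmf" where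
  "mixture X = bind_pmf (pmf_of_set UNIV) X"

lemma pmf_mixture:
  fixes X :: "'i::finite \<Rightarrow> 'a pmf"
  shows "pmf (mixture X) v = 1 / real CARD('i) * (\<Sum>i\<in>UNIV. pmf (X i) v)"
  by (simp add: mixture_def pmf_bind_pmf_of_set)

text \<open>If \<open>\<phi> = (X\<^sub>1, \<dots>, X\<^sub>q)\<close>, then \<open>\<phi> \<circ> \<sigma>\<close> is the permuted tuple with entries \<open>X\<^bsub>\<sigma>(i)\<^esub>\<close>.\<close>

definition random_embedding ::
    "'q::finite set set \<Rightarrow> 'n::finite set set \<Rightarrow> ('q \<Rightarrow> 'n) pmf \<Rightarrow> bool" where
  "random_embedding Q H p \<longleftrightarrow>
     set_pmf p \<subseteq> Inj Q H \<and> (\<forall>\<sigma>\<in>Aut Q. map_pmf (\<lambda>\<phi>. \<phi> \<circ> \<sigma>) p = p)"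

definition entropic_value :: "real \<Rightarrow> ('q::finite \<Rightarrow> 'n::finite) pmf \<Rightarrow> real" where
  "entropic_value \<alpha> p =
     2 powr (shannon_entropy p
       - real CARD('q) / \<alpha> * shannon_entropy (mixture (\<lambda>i. map_pmf (\<lambda>\<phi>. \<phi> i) p)))"

definition entropic_density :: "real \<Rightarrow> 'q::finite set set \<Rightarrow> 'n::finite set set \<Rightarrow> real" where
  "entropic_density \<alpha> Q H =
     (if Inj Q H = {} then 0
      else (GREATEST m. m \<in> entropic_value \<alpha> ` {p. random_embedding Q H p}))"


lemma lagrangian_max_exists:
  fixes Q :: "'q::finite set set" and H :: "'n::finite set set"
  assumes "\<alpha> \<ge> 1"
  shows "\<exists>x\<in>alpha_sphere \<alpha>. \<forall>y\<in>alpha_sphere \<alpha>. lagrange_poly Q H y \<le> lagrange_poly Q H x"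
proof -
  let ?S = "alpha_sphere \<alpha> :: (real ^ 'n) set"
  have cont: "continuous_on UNIV (\<lambda>x::real^'n. \<Sum>i\<in>UNIV. \<bar>x $ i\<bar> powr \<alpha>)"
    using assms by (intro continuous_intros continuous_on_powr') auto
  have cl: "closed ?S"
    unfolding alpha_sphere_def
    using continuous_closed_vimage[of "{1::real}"] closed_Collect_eq[OF cont continuous_on_const]
    by simp
  have "\<bar>x $ i\<bar> \<le> 1" if "x \<in> ?S" for x i
  proof (rule ccontr)
    assume "\<not> \<bar>x $ i\<bar> \<le> 1"
    then have "1 < \<bar>x $ i\<bar> powr \<alpha>"
      using assms by (intro gr_one_powr) auto
    also have "\<dots> \<le> (\<Sum>i\<in>UNIV. \<bar>x $ i\<bar> powr \<alpha>)"
      by (rule member_le_sum) auto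
    finally show False using that by (simp add: alpha_sphere_def)
  qed
  then have "norm x \<le> (\<Sum>i\<in>(UNIV::'n set). 1)" if "x \<in> ?S" for x
    using that by (intro order_trans[OF norm_le_l1_cart] sum_mono) auto
  then have "bounded ?S" unfolding bounded_iff by blast
  with cl have "compact ?S" by (simp add: compact_eq_bounded_closed)
  moreover have "axis (undefined::'n) 1 \<in> ?S"
  proof -
    have "(\<Sum>i\<in>UNIV. \<bar>(axis (undefined::'n) (1::real)) $ i\<bar> powr \<alpha>)
        = (\<Sum>i\<in>UNIV. if i = (undefined::'n) then 1 else 0)"
      by (intro sum.cong) (auto simp: axis_def)
    then show ?thesis by (simp add: alpha_sphere_def)
  qed
  moreover have "continuous_on ?S (lagrange_poly Q H)"
    unfolding lagrange_poly_def by (intro continuous_intros)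
  ultimately show ?thesis
    using continuous_attains_sup[of ?S "lagrange_poly Q H"] by blast
qed

lemma continuous_on_xlog: "continuous_on {0..} (\<lambda>x::real. x * log 2 x)"
proof -
  have "((\<lambda>x::real. x * log 2 x) \<longlongrightarrow> 0) (at_right 0)"
    by real_asymp
  moreover have "((\<lambda>x::real. x * log 2 x) \<longlongrightarrow> x * log 2 x) (at x within {0..})" if "x > 0" for x
    using that by (intro tendsto_intros) auto
  ultimately have "((\<lambda>x::real. x * log 2 x) \<longlongrightarrow> x * log 2 x) (at x within {0..})" if "x \<ge> 0" for x
    using that by (cases "x = 0") (auto simp: at_within_Ici_at_right)
  then show ?thesis by (simp add: continuous_on_def)
qed

lemma uniform_random_embedding:
  fixes Q :: "'q::finite set set" and H :: "'n::finite set set"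
  assumes "Inj Q H \<noteq> {}"
  shows "random_embedding Q H (pmf_of_set (Inj Q H))"
proof -
  have "map_pmf (\<lambda>\<phi>. \<phi> \<circ> \<sigma>) (pmf_of_set (Inj Q H)) = pmf_of_set (Inj Q H)" if s: "\<sigma> \<in> Aut Q" for \<sigma>
  proof -
    have "surj \<sigma>" using s by (simp add: Aut_def Inj_def finite_UNIV_inj_surj)
    then have inj: "inj_on (\<lambda>\<phi>. \<phi> \<circ> \<sigma>) (Inj Q H)"
      by (auto simp: inj_on_def fun_eq_iff surj_def) metis
    have "(\<lambda>\<phi>. \<phi> \<circ> \<sigma>) ` Inj Q H \<subseteq> Inj Q H"
      using s by (auto simp: Aut_def Inj_def image_comp[symmetric] simp del: o_apply intro: inj_compose)
    then have "(\<lambda>\<phi>. \<phi> \<circ> \<sigma>) ` Inj Q H = Inj Q H"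
      using inj by (intro endo_inj_surj) auto
    then show ?thesis
      using map_pmf_of_set_inj[OF inj assms] by simp
  qed
  then show ?thesis using assms by (auto simp: random_embedding_def)
qed

lemma entropic_max_exists:
  fixes Q :: "'q::finite set set" and H :: "'n::finite set set"
  assumes "Inj Q H \<noteq> {}"
  shows "\<exists>p. random_embedding Q H p \<and>
    (\<forall>p'. random_embedding Q H p' \<longrightarrow> entropic_value \<alpha> p' \<le> entropic_value \<alpha> p)"
proof -
  define S :: "(real ^ ('q \<Rightarrow> 'n)) set" where
    "S = {w. \<forall>\<phi>. 0 \<le> w $ \<phi>} \<inter> {w. (\<Sum>\<phi>\<in>UNIV. w $ \<phi>) = 1} \<inter> {w. \<forall>\<phi>. \<phi> \<notin> Inj Q H \<longrightarrow> w $ \<phi> = 0}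
       \<inter> {w. \<forall>\<sigma> \<phi>. \<sigma> \<in> Aut Q \<longrightarrow> w $ \<phi> = w $ (\<phi> \<circ> \<sigma>)}"
  define m where "m w v = 1 / real CARD('q) * (\<Sum>i\<in>UNIV. \<Sum>\<phi>\<in>{\<phi>. \<phi> i = v}. w $ \<phi>)"
    for w :: "real ^ ('q \<Rightarrow> 'n)" and v :: 'n
  define F :: "real ^ ('q \<Rightarrow> 'n) \<Rightarrow> real" where
    "F w = 2 powr (- (\<Sum>\<phi>\<in>UNIV. w $ \<phi> * log 2 (w $ \<phi>))
       - real CARD('q) / \<alpha> * - (\<Sum>v\<in>UNIV. m w v * log 2 (m w v)))" for w
  define vec where "vec p = (\<chi> \<phi>. pmf p \<phi>)" for p :: "('q \<Rightarrow> 'n) pmf"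

  have pm: "pmf (mixture (\<lambda>i. map_pmf (\<lambda>\<phi>. \<phi> i) p)) v = m (vec p) v" for p v
    by (auto simp: pmf_mixture m_def vec_def pmf_map vimage_def measure_measure_pmf_finite)
  have F: "entropic_value \<alpha> p = F (vec p)" for p
    by (simp add: entropic_value_def F_def shannon_entropy_def pm) (simp add: vec_def)

  have sym: "(map_pmf (\<lambda>\<phi>. \<phi> \<circ> \<sigma>) p = p) \<longleftrightarrow> (\<forall>\<phi>. pmf p \<phi> = pmf p (\<phi> \<circ> \<sigma>))"
    if "\<sigma> \<in> Aut Q" for \<sigma> and p :: "('q \<Rightarrow> 'n) pmf"
  proof -
    have "surj \<sigma>" using that by (simp add: Aut_def Inj_def finite_UNIV_inj_surj)
    then have inj: "inj (\<lambda>\<phi> :: 'q \<Rightarrow> 'n. \<phi> \<circ> \<sigma>)"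
      by (auto simp: inj_on_def fun_eq_iff surj_def) metis
    then have sj: "surj (\<lambda>\<phi> :: 'q \<Rightarrow> 'n. \<phi> \<circ> \<sigma>)"
      by (intro finite_UNIV_inj_surj) auto
    have eq: "pmf (map_pmf (\<lambda>\<phi>. \<phi> \<circ> \<sigma>) p) (\<phi> \<circ> \<sigma>) = pmf p \<phi>" for \<phi>
      by (rule pmf_map_inj'[OF inj])
    show ?thesis
    proof
      assume "map_pmf (\<lambda>\<phi>. \<phi> \<circ> \<sigma>) p = p"
      then show "\<forall>\<phi>. pmf p \<phi> = pmf p (\<phi> \<circ> \<sigma>)" using eq by simp
    next
      assume *: "\<forall>\<phi>. pmf p \<phi> = pmf p (\<phi> \<circ> \<sigma>)"
      show "map_pmf (\<lambda>\<phi>. \<phi> \<circ> \<sigma>) p = p"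
      proof (rule pmf_eqI)
        fix \<psi> :: "'q \<Rightarrow> 'n"
        obtain \<phi> where "\<psi> = \<phi> \<circ> \<sigma>" using sj by (meson surjD)
        then show "pmf (map_pmf (\<lambda>\<phi>. \<phi> \<circ> \<sigma>) p) \<psi> = pmf p \<psi>" using eq * by metis
      qed
    qed
  qed
  have vec_S: "vec p \<in> S \<longleftrightarrow> random_embedding Q H p" for p
  proof -
    have "(\<Sum>\<phi>\<in>UNIV. pmf p \<phi>) = 1" by (rule sum_pmf_eq_1) auto
    moreover have "set_pmf p \<subseteq> Inj Q H \<longleftrightarrow> (\<forall>\<phi>. \<phi> \<notin> Inj Q H \<longrightarrow> pmf p \<phi> = 0)"
      by (auto simp: set_pmf_iff)
    moreover have "($) (vec_lambda (pmf p)) = pmf p" by (simp add: fun_eq_iff)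
    ultimately show ?thesis
      using sym[of _ p] unfolding S_def random_embedding_def vec_def
      by (simp only: Int_iff mem_Collect_eq vec_lambda_beta pmf_nonneg) blast
  qed
  have S_vec: "\<exists>p. w = vec p" if "w \<in> S" for w
  proof
    have nn: "\<And>\<phi>. 0 \<le> w $ \<phi>" and s1: "(\<Sum>\<phi>\<in>UNIV. w $ \<phi>) = 1"
      using that unfolding S_def by blast+
    have "(\<integral>\<^sup>+\<phi>. ennreal (w $ \<phi>) \<partial>count_space UNIV) = 1"
      using nn s1 by (simp add: nn_integral_count_space_finite)
    then show "w = vec (embed_pmf (\<lambda>\<phi>. w $ \<phi>))"
      using nn by (simp add: vec_def vec_eq_iff pmf_embed_pmf)
  qed

  have clS: "closed S"
    unfolding S_def
    by (intro closed_Int closed_Collect_all closed_Collect_imp closed_Collect_le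
        closed_Collect_eq continuous_intros open_Collect_const)
  have nonneg: "0 \<le> w $ \<phi>" and sum1: "(\<Sum>\<phi>\<in>UNIV. w $ \<phi>) = 1" if "w \<in> S" for w \<phi>
    using that unfolding S_def by blast+
  have w1: "\<bar>w $ \<phi>\<bar> \<le> 1" if "w \<in> S" for w \<phi>
    using nonneg[OF that] sum1[OF that] member_le_sum[of \<phi> UNIV "\<lambda>\<phi>. w $ \<phi>"] by simp
  then have "norm w \<le> (\<Sum>\<phi>\<in>(UNIV::('q \<Rightarrow> 'n) set). 1)" if "w \<in> S" for w
    using that by (intro order_trans[OF norm_le_l1_cart] sum_mono) auto
  then have "bounded S" unfolding bounded_iff by blast
  with clS have "compact S" by (simp add: compact_eq_bounded_closed)
  moreover have "S \<noteq> {}"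
    using uniform_random_embedding[OF assms] vec_S by blast
  moreover have "continuous_on S F"
  proof -
    have c1: "continuous_on S (\<lambda>w. w $ \<phi> * log 2 (w $ \<phi>))" for \<phi>
      by (rule continuous_on_compose2[OF continuous_on_xlog])
         (auto simp: nonneg intro!: continuous_intros)
    have c2: "continuous_on S (\<lambda>w. m w v * log 2 (m w v))" for v
      by (rule continuous_on_compose2[OF continuous_on_xlog])
         (auto simp: m_def nonneg intro!: continuous_intros sum_nonneg divide_nonneg_nonneg)
    show ?thesis
      unfolding F_def
      by (intro continuous_intros c1 c2) auto
  qed
  ultimately obtain w where "w \<in> S" "\<forall>w'\<in>S. F w' \<le> F w"
    using continuous_attains_sup[of S F] by blast
  then show ?thesis
    using S_vec vec_S F by metis
qed

end

theory Submission
  imports Defs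
begin

text \<open>
  Both sides are the two iterated maxima of one functional. For a random embedding with law \<open>p\<close>,
  let \<open>m\<close> be the mixture of its marginals, and for a nonnegative vector \<open>x\<close> on the
  \<open>\<alpha>\<close>-sphere put
  \<open>F(p, x) = \<H>[p] + q * (\<Sum>v. m v * log 2 (x\<^sub>v))\<close>,
  read as \<open>-\<infinity>\<close> if some \<open>x\<^sub>v\<close> vanishes on the support of \<open>m\<close>.

  By Gibbs' inequality on the set of embeddings, \<open>F(p, x) \<le> log 2 (P x)\<close>, where \<open>P\<close> is the
  Lagrange polynomial: the second summand of \<open>F\<close> is the expectation under \<open>p\<close> of the logarithm of
  the monomial of the random embedding. Equality holds when \<open>p\<close> is proportional to the monomials,
  and this choice of \<open>p\<close> is symmetric because the monomial depends only on the image of the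
  embedding. By Gibbs' inequality on the set of vertices, applied to the probability vector
  \<open>x\<^sub>v powr \<alpha>\<close>, also \<open>F(p, x) \<le> \<H>[p] - q / \<alpha> * \<H>[m]\<close>, with equality when
  \<open>x\<^sub>v powr \<alpha> = m v\<close>. Hence maximising \<open>F\<close> over \<open>p\<close> first gives \<open>log 2\<close> of the Lagrangian, and
  maximising over \<open>x\<close> first gives \<open>log 2\<close> of the entropic density.
  Vectors with negative coordinates do not affect the Lagrangian, because replacing coordinates by
  their absolute values stays on the sphere and does not decrease \<open>P\<close>.
\<close>

section \<open>Gibbs' inequality\<close>

text \<open>
  The inequality is \<open>ln t \<le> t - 1\<close> at \<open>t = w a / (Z * p a)\<close>, averaged over \<open>p\<close>, with \<open>Z\<close> the
  total weight.
\<close>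

lemma gibbs_inequality:
  fixes p :: "'a::finite pmf" and w :: "'a \<Rightarrow> real"
  assumes sub: "set_pmf p \<subseteq> A"
    and nonneg: "\<And>a. a \<in> A \<Longrightarrow> 0 \<le> w a"
    and pos: "\<And>a. a \<in> set_pmf p \<Longrightarrow> 0 < w a"
  shows "shannon_entropy p + (\<Sum>a\<in>UNIV. pmf p a * log 2 (w a)) \<le> log 2 (\<Sum>a\<in>A. w a)"
proof -
  define Z where "Z = (\<Sum>a\<in>A. w a)"
  have p_sum: "(\<Sum>a\<in>UNIV. pmf p a) = 1"
    by (rule sum_pmf_eq_1) auto
  obtain b where b: "b \<in> set_pmf p"
    using set_pmf_not_empty[of p] by blast
  have "w b \<le> Z"
    unfolding Z_def using b sub nonneg by (intro member_le_sum) auto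
  with pos[OF b] have Z: "Z > 0" by simp
  have pointwise: "pmf p a * (ln (w a) - ln (pmf p a) - ln Z) \<le> (if a \<in> A then w a / Z else 0) - pmf p a"
    for a
  proof (cases "a \<in> set_pmf p")
    case True
    then have pa: "pmf p a > 0" by (simp add: pmf_positive)
    have wa: "w a > 0" using pos True by simp
    have "ln (w a) - ln (pmf p a) - ln Z = ln (w a / (pmf p a * Z))"
      using pa wa Z by (simp add: ln_div ln_mult)
    also have "\<dots> \<le> w a / (pmf p a * Z) - 1"
      using pa wa Z by (intro ln_le_minus_one) simp
    finally have "pmf p a * (ln (w a) - ln (pmf p a) - ln Z) \<le> pmf p a * (w a / (pmf p a * Z) - 1)"
      using pa by (intro mult_left_mono) auto
    also have "\<dots> = w a / Z - pmf p a"
      using pa Z by (simp add: field_simps)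
    finally show ?thesis using True sub by auto
  next
    case False
    then show ?thesis using nonneg Z by (auto simp: set_pmf_iff)
  qed
  have "(\<Sum>a\<in>UNIV. pmf p a * (ln (w a) - ln (pmf p a) - ln Z))
      \<le> (\<Sum>a\<in>UNIV. (if a \<in> A then w a / Z else 0) - pmf p a)"
    by (intro sum_mono pointwise)
  also have "\<dots> = (\<Sum>a\<in>A. w a / Z) - 1"
    by (simp add: sum_subtractf p_sum flip: sum.inter_filter)
  also have "\<dots> = 0"
    using Z by (simp add: Z_def flip: sum_divide_distrib)
  finally have "(\<Sum>a\<in>UNIV. pmf p a * ln (w a)) - (\<Sum>a\<in>UNIV. pmf p a * ln (pmf p a)) \<le> ln Z"
    by (simp add: right_diff_distrib sum_subtractf p_sum flip: sum_distrib_right)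
  then have "((\<Sum>a\<in>UNIV. pmf p a * ln (w a)) - (\<Sum>a\<in>UNIV. pmf p a * ln (pmf p a))) / ln 2 \<le> ln Z / ln 2"
    by (intro divide_right_mono) auto
  then show ?thesis
    by (simp add: shannon_entropy_def log_def Z_def diff_divide_distrib sum_divide_distrib)
qed

text \<open>The equality case: \<open>p\<close> is the normalisation of the weights, wherever it is positive.\<close>

lemma gibbs_equality:
  fixes p :: "'a::finite pmf" and w :: "'a \<Rightarrow> real"
  assumes p: "\<And>a. a \<in> set_pmf p \<Longrightarrow> pmf p a = w a / Z"
    and pos: "\<And>a. a \<in> set_pmf p \<Longrightarrow> 0 < w a"
    and Z: "Z > 0"
  shows "shannon_entropy p + (\<Sum>a\<in>UNIV. pmf p a * log 2 (w a)) = log 2 Z"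
proof -
  have "pmf p a * log 2 (pmf p a) = pmf p a * log 2 (w a) - pmf p a * log 2 Z" for a
  proof (cases "a \<in> set_pmf p")
    case True
    have "log 2 (pmf p a) = log 2 (w a) - log 2 Z"
      using p[OF True] pos[OF True] Z by (simp add: log_divide)
    then show ?thesis by (simp add: right_diff_distrib)
  qed (simp add: set_pmf_iff)
  moreover have "(\<Sum>a\<in>UNIV. pmf p a) = 1"
    by (rule sum_pmf_eq_1) auto
  ultimately show ?thesis
    by (simp add: shannon_entropy_def sum_subtractf flip: sum_distrib_right)
qed

section \<open>The mixture of the marginals of a random tuple\<close>

abbreviation marginal_mixture :: "('q::finite \<Rightarrow> 'n::finite) pmf \<Rightarrow> 'n pmf" where
  "marginal_mixture p \<equiv> mixture (\<lambda>i. map_pmf (\<lambda>\<phi>. \<phi> i) p)"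

lemma set_pmf_marginal_mixture: "set_pmf (marginal_mixture p) = (\<Union>\<phi>\<in>set_pmf p. range \<phi>)"
  by (auto simp: mixture_def)

text \<open>
  Linearity of expectation: a uniformly random coordinate of the tuple has law
  \<open>marginal_mixture p\<close>.
\<close>

lemma expectation_sum_coordinates:
  fixes p :: "('q::finite \<Rightarrow> 'n::finite) pmf" and f :: "'n \<Rightarrow> real"
  shows "(\<Sum>\<phi>\<in>UNIV. pmf p \<phi> * (\<Sum>i\<in>UNIV. f (\<phi> i)))
       = real CARD('q) * (\<Sum>v\<in>UNIV. pmf (marginal_mixture p) v * f v)"
proof -
  have coord: "(\<Sum>v\<in>UNIV. pmf (map_pmf (\<lambda>\<phi>. \<phi> i) p) v * f v) = (\<Sum>\<phi>\<in>UNIV. pmf p \<phi> * f (\<phi> i))" for i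
  proof -
    have "(\<Sum>v\<in>UNIV. pmf (map_pmf (\<lambda>\<phi>. \<phi> i) p) v * f v)
        = (\<Sum>v\<in>UNIV. \<Sum>\<phi>\<in>{\<phi>. \<phi> i = v}. pmf p \<phi> * f (\<phi> i))"
      by (simp add: pmf_map vimage_def measure_measure_pmf_finite sum_distrib_right)
    also have "\<dots> = (\<Sum>\<phi>\<in>UNIV. pmf p \<phi> * f (\<phi> i))"
      using sum.group[of "UNIV :: ('q \<Rightarrow> 'n) set" UNIV "\<lambda>\<phi>. \<phi> i" "\<lambda>\<phi>. pmf p \<phi> * f (\<phi> i)"] by simp
    finally show ?thesis .
  qed
  have "real CARD('q) * (\<Sum>v\<in>UNIV. pmf (marginal_mixture p) v * f v)
      = (\<Sum>v\<in>UNIV. \<Sum>i\<in>UNIV. pmf (map_pmf (\<lambda>\<phi>. \<phi> i) p) v * f v)"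
    by (simp add: pmf_mixture sum_distrib_left sum_distrib_right)
  also have "\<dots> = (\<Sum>i\<in>UNIV. \<Sum>\<phi>\<in>UNIV. pmf p \<phi> * f (\<phi> i))"
    by (subst sum.swap) (simp add: coord)
  finally show ?thesis
    by (subst (asm) sum.swap) (simp add: sum_distrib_left)
qed

text \<open>
  This identifies the second summand of the functional \<open>F\<close> with the expected logarithm of the
  monomial; injectivity is what makes the monomial a product over coordinates.
\<close>

lemma expectation_log_monomial:
  fixes p :: "('q::finite \<Rightarrow> 'n::finite) pmf" and x :: "real ^ 'n"
  assumes inj: "\<And>\<phi>. \<phi> \<in> set_pmf p \<Longrightarrow> inj \<phi>"
    and pos: "\<And>v. v \<in> set_pmf (marginal_mixture p) \<Longrightarrow> 0 < x $ v"
  shows "(\<Sum>\<phi>\<in>UNIV. pmf p \<phi> * log 2 (\<Prod>v\<in>range \<phi>. x $ v))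
       = real CARD('q) * (\<Sum>v\<in>UNIV. pmf (marginal_mixture p) v * log 2 (x $ v))"
proof -
  have "pmf p \<phi> * log 2 (\<Prod>v\<in>range \<phi>. x $ v) = pmf p \<phi> * (\<Sum>i\<in>UNIV. log 2 (x $ (\<phi> i)))" for \<phi>
  proof (cases "\<phi> \<in> set_pmf p")
    case True
    then have "x $ (\<phi> i) > 0" for i
      using pos unfolding set_pmf_marginal_mixture by blast
    then have "log 2 (\<Prod>i\<in>UNIV. x $ (\<phi> i)) = (\<Sum>i\<in>UNIV. log 2 (x $ (\<phi> i)))"
      by (simp add: log_def ln_prod sum_divide_distrib less_imp_neq[symmetric])
    moreover have "(\<Prod>v\<in>range \<phi>. x $ v) = (\<Prod>i\<in>UNIV. x $ (\<phi> i))"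
      using prod.reindex[OF inj[OF True]] by simp
    ultimately show ?thesis by simp
  qed (simp add: set_pmf_iff)
  then have "(\<Sum>\<phi>\<in>UNIV. pmf p \<phi> * log 2 (\<Prod>v\<in>range \<phi>. x $ v))
      = (\<Sum>\<phi>\<in>UNIV. pmf p \<phi> * (\<Sum>i\<in>UNIV. log 2 (x $ (\<phi> i))))"
    by (intro sum.cong) auto
  then show ?thesis
    by (simp only: expectation_sum_coordinates[of p "\<lambda>v. log 2 (x $ v)"])
qed

section \<open>From random embeddings to vectors\<close>

lemma entropic_value_le_lagrange_poly:
  fixes Q :: "'q::finite set set" and H :: "'n::finite set set"
  assumes p: "random_embedding Q H p" and \<alpha>: "\<alpha> > 0"
  shows "\<exists>x\<in>alpha_sphere \<alpha>. entropic_value \<alpha> p \<le> lagrange_poly Q H x"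
proof
  define m where "m = marginal_mixture p"
  \<comment> \<open>The maximiser of \<open>F(p, x)\<close> for fixed \<open>p\<close>: the equality case on the set of vertices.\<close>
  define x :: "real ^ 'n" where "x = (\<chi> v. pmf m v powr (1 / \<alpha>))"
  have sub: "set_pmf p \<subseteq> Inj Q H" using p by (simp add: random_embedding_def)
  have "(\<Sum>v\<in>UNIV. \<bar>x $ v\<bar> powr \<alpha>) = (\<Sum>v\<in>UNIV. pmf m v)"
    using \<alpha> by (intro sum.cong) (auto simp: x_def powr_powr)
  also have "\<dots> = 1" by (rule sum_pmf_eq_1) auto
  finally show "x \<in> alpha_sphere \<alpha>" by (simp add: alpha_sphere_def)
  have x_pos: "x $ v > 0" if "v \<in> set_pmf m" for v
    using that by (simp add: x_def set_pmf_iff)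
  have mono_pos: "(\<Prod>v\<in>range \<phi>. x $ v) > 0" if "\<phi> \<in> set_pmf p" for \<phi>
    using that x_pos unfolding m_def set_pmf_marginal_mixture by (intro prod_pos) blast
  have mono_nonneg: "(\<Prod>v\<in>range \<phi>. x $ v) \<ge> 0" for \<phi> :: "'q \<Rightarrow> 'n"
    by (intro prod_nonneg) (simp add: x_def)
  obtain \<phi> where \<phi>: "\<phi> \<in> set_pmf p" using set_pmf_not_empty[of p] by blast
  have "(\<Prod>v\<in>range \<phi>. x $ v) \<le> lagrange_poly Q H x"
    unfolding lagrange_poly_def using \<phi> sub mono_nonneg by (intro member_le_sum) auto
  with mono_pos[OF \<phi>] have P_pos: "lagrange_poly Q H x > 0" by simp
  have "(\<Sum>v\<in>UNIV. pmf m v * log 2 (x $ v)) = (\<Sum>v\<in>UNIV. pmf m v * log 2 (pmf m v)) / \<alpha>"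
    unfolding sum_divide_distrib
    by (intro sum.cong) (auto simp: x_def log_powr)
  then have "shannon_entropy p - real CARD('q) / \<alpha> * shannon_entropy m
      = shannon_entropy p + real CARD('q) * (\<Sum>v\<in>UNIV. pmf m v * log 2 (x $ v))"
    by (simp add: shannon_entropy_def)
  also have "\<dots> = shannon_entropy p + (\<Sum>\<phi>\<in>UNIV. pmf p \<phi> * log 2 (\<Prod>v\<in>range \<phi>. x $ v))"
    using sub x_pos unfolding m_def
    by (subst expectation_log_monomial) (auto simp: Inj_def)
  also have "\<dots> \<le> log 2 (lagrange_poly Q H x)"
    unfolding lagrange_poly_def using sub mono_nonneg mono_pos by (rule gibbs_inequality)
  finally show "entropic_value \<alpha> p \<le> lagrange_poly Q H x"
    using P_pos by (simp add: entropic_value_def m_def le_log_iff)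
qed

section \<open>From vectors to random embeddings\<close>

lemma Aut_imp_surj: "\<sigma> \<in> Aut Q \<Longrightarrow> surj \<sigma>"
  by (simp add: Aut_def Inj_def finite_UNIV_inj_surj)

lemma inj_comp_right:
  assumes "surj \<sigma>"
  shows "inj (\<lambda>\<phi>. \<phi> \<circ> \<sigma>)"
proof (rule injI)
  fix \<phi> \<psi>
  assume eq: "\<phi> \<circ> \<sigma> = \<psi> \<circ> \<sigma>"
  show "\<phi> = \<psi>"
  proof
    fix i
    obtain j where "i = \<sigma> j" using assms by (meson surjD)
    then show "\<phi> i = \<psi> i" using fun_cong[OF eq, of j] by simp
  qed
qed

text \<open>
  The backward direction says that \<open>\<sigma>\<inverse>\<close> also preserves edges. This is the pigeonhole principle,
  applied to the action of \<open>\<sigma>\<close> on the finite set of embeddings.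
\<close>

lemma Inj_comp_Aut_iff:
  fixes Q :: "'q::finite set set" and H :: "'n::finite set set"
  assumes \<sigma>: "\<sigma> \<in> Aut Q"
  shows "\<phi> \<circ> \<sigma> \<in> Inj Q H \<longleftrightarrow> \<phi> \<in> Inj Q H"
proof
  have inj: "inj (\<lambda>\<phi> :: 'q \<Rightarrow> 'n. \<phi> \<circ> \<sigma>)"
    by (rule inj_comp_right[OF Aut_imp_surj[OF \<sigma>]])
  have closed: "\<psi> \<circ> \<sigma> \<in> Inj Q H" if "\<psi> \<in> Inj Q H" for \<psi>
    using \<sigma> that unfolding Aut_def Inj_def
    by (auto simp: image_comp[symmetric] simp del: o_apply intro: inj_compose)
  have "(\<lambda>\<phi>. \<phi> \<circ> \<sigma>) ` Inj Q H = Inj Q H"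
    using closed by (intro endo_inj_surj inj_on_subset[OF inj]) auto
  then show "\<phi> \<in> Inj Q H" if "\<phi> \<circ> \<sigma> \<in> Inj Q H"
    using that inj_image_mem_iff[OF inj, of \<phi> "Inj Q H"] by simp
  show "\<phi> \<circ> \<sigma> \<in> Inj Q H" if "\<phi> \<in> Inj Q H"
    using that by (rule closed)
qed

text \<open>The Gibbs distribution of the monomials, for which the bound of \<open>F\<close> by \<open>log 2 (P x)\<close> is sharp.\<close>

lemma monomial_distribution_exists:
  fixes Q :: "'q::finite set set" and H :: "'n::finite set set" and x :: "real ^ 'n"
  assumes nonneg: "\<And>v. 0 \<le> x $ v" and P_pos: "lagrange_poly Q H x > 0"
  obtains p where "random_embedding Q H p"
    and "\<And>\<phi>. \<phi> \<in> set_pmf p \<Longrightarrow> pmf p \<phi> = (\<Prod>v\<in>range \<phi>. x $ v) / lagrange_poly Q H x"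
proof
  define d where
    "d \<phi> = (if \<phi> \<in> Inj Q H then (\<Prod>v\<in>range \<phi>. x $ v) / lagrange_poly Q H x else 0)" for \<phi>
  define p where "p = embed_pmf d"
  have d_nonneg: "d \<phi> \<ge> 0" for \<phi>
    using nonneg P_pos by (simp add: d_def prod_nonneg)
  have "(\<Sum>\<phi>\<in>UNIV. d \<phi>) = (\<Sum>\<phi>\<in>Inj Q H. (\<Prod>v\<in>range \<phi>. x $ v) / lagrange_poly Q H x)"
    by (simp add: d_def flip: sum.inter_filter)
  also have "\<dots> = 1"
    using P_pos by (simp add: lagrange_poly_def flip: sum_divide_distrib)
  finally have "(\<integral>\<^sup>+\<phi>. ennreal (d \<phi>) \<partial>count_space UNIV) = 1"
    using d_nonneg by (simp add: nn_integral_count_space_finite)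
  then have pmf_p: "pmf p \<phi> = d \<phi>" for \<phi>
    using d_nonneg by (simp add: p_def pmf_embed_pmf)
  show "pmf p \<phi> = (\<Prod>v\<in>range \<phi>. x $ v) / lagrange_poly Q H x" if "\<phi> \<in> set_pmf p" for \<phi>
    using that by (auto simp: pmf_p d_def set_pmf_iff split: if_splits)
  have "map_pmf (\<lambda>\<phi>. \<phi> \<circ> \<sigma>) p = p" if \<sigma>: "\<sigma> \<in> Aut Q" for \<sigma>
  proof (rule pmf_eqI)
    fix \<psi> :: "'q \<Rightarrow> 'n"
    have inj: "inj (\<lambda>\<phi> :: 'q \<Rightarrow> 'n. \<phi> \<circ> \<sigma>)"
      by (rule inj_comp_right[OF Aut_imp_surj[OF \<sigma>]])
    then have "surj (\<lambda>\<phi> :: 'q \<Rightarrow> 'n. \<phi> \<circ> \<sigma>)"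
      by (intro finite_UNIV_inj_surj) auto
    then obtain \<phi> where \<phi>: "\<psi> = \<phi> \<circ> \<sigma>" by (meson surjD)
    have "range (\<phi> \<circ> \<sigma>) = range \<phi>"
      using Aut_imp_surj[OF \<sigma>] by (metis image_comp)
    then have "d (\<phi> \<circ> \<sigma>) = d \<phi>"
      unfolding d_def by (simp only: Inj_comp_Aut_iff[OF \<sigma>])
    then show "pmf (map_pmf (\<lambda>\<phi>. \<phi> \<circ> \<sigma>) p) \<psi> = pmf p \<psi>"
      unfolding \<phi> pmf_map_inj'[OF inj] pmf_p by simp
  qed
  then show "random_embedding Q H p"
    by (auto simp: random_embedding_def set_pmf_iff pmf_p d_def split: if_splits)
qed

lemma lagrange_poly_le_entropic_value:
  fixes Q :: "'q::finite set set" and H :: "'n::finite set set" and x :: "real ^ 'n"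
  assumes nonneg: "\<And>v. 0 \<le> x $ v" and sphere: "x \<in> alpha_sphere \<alpha>"
    and P_pos: "lagrange_poly Q H x > 0" and \<alpha>: "\<alpha> > 0"
  shows "\<exists>p. random_embedding Q H p \<and> lagrange_poly Q H x \<le> entropic_value \<alpha> p"
proof -
  obtain p where p: "random_embedding Q H p"
    and pmf_p: "\<And>\<phi>. \<phi> \<in> set_pmf p \<Longrightarrow> pmf p \<phi> = (\<Prod>v\<in>range \<phi>. x $ v) / lagrange_poly Q H x"
    using monomial_distribution_exists[OF nonneg P_pos] by blast
  define m where "m = marginal_mixture p"
  have mono_pos: "(\<Prod>v\<in>range \<phi>. x $ v) > 0" if "\<phi> \<in> set_pmf p" for \<phi>
    using pmf_p[OF that] pmf_positive[OF that] P_pos by (simp add: zero_less_divide_iff)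
  have x_pos: "x $ v > 0" if v: "v \<in> set_pmf m" for v
  proof -
    obtain \<phi> where \<phi>: "\<phi> \<in> set_pmf p" "v \<in> range \<phi>"
      using v unfolding m_def set_pmf_marginal_mixture by blast
    have "x $ v \<noteq> 0"
    proof
      assume "x $ v = 0"
      with \<phi>(2) have "(\<Prod>v\<in>range \<phi>. x $ v) = 0" by (intro prod_zero) auto
      with mono_pos[OF \<phi>(1)] show False by simp
    qed
    then show ?thesis using nonneg[of v] by simp
  qed
  have "log 2 (lagrange_poly Q H x)
      = shannon_entropy p + (\<Sum>\<phi>\<in>UNIV. pmf p \<phi> * log 2 (\<Prod>v\<in>range \<phi>. x $ v))"
    using gibbs_equality[OF pmf_p mono_pos P_pos] by simp
  also have "\<dots> = shannon_entropy p + real CARD('q) * (\<Sum>v\<in>UNIV. pmf m v * log 2 (x $ v))"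
    using p x_pos unfolding m_def
    by (subst expectation_log_monomial) (auto simp: Inj_def random_embedding_def)
  also have "(\<Sum>v\<in>UNIV. pmf m v * log 2 (x $ v)) \<le> - shannon_entropy m / \<alpha>"
  proof -
    have "shannon_entropy m + (\<Sum>v\<in>UNIV. pmf m v * log 2 (x $ v powr \<alpha>))
        \<le> log 2 (\<Sum>v\<in>UNIV. x $ v powr \<alpha>)"
      by (rule gibbs_inequality) (use x_pos in fastforce)+
    also have "(\<Sum>v\<in>UNIV. x $ v powr \<alpha>) = 1"
      using sphere nonneg by (simp add: alpha_sphere_def)
    also have "(\<Sum>v\<in>UNIV. pmf m v * log 2 (x $ v powr \<alpha>)) = (\<Sum>v\<in>UNIV. pmf m v * log 2 (x $ v)) * \<alpha>"
      unfolding sum_distrib_right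
      by (intro sum.cong) (auto simp: log_powr)
    finally show ?thesis using \<alpha> by (simp add: field_simps)
  qed
  finally have "log 2 (lagrange_poly Q H x)
      \<le> shannon_entropy p - real CARD('q) / \<alpha> * shannon_entropy m"
    by (simp add: mult_left_mono)
  then have "lagrange_poly Q H x \<le> entropic_value \<alpha> p"
    using P_pos by (simp add: entropic_value_def m_def log_le_iff)
  with p show ?thesis by blast
qed

section \<open>Equality of the two maxima\<close>

lemma lagrange_poly_le_abs: "lagrange_poly Q H x \<le> lagrange_poly Q H (\<chi> v. \<bar>x $ v\<bar>)"
  unfolding lagrange_poly_def
  by (rule sum_mono) (simp flip: abs_prod)

theorem proposition5p1:
  fixes Q :: "'q::finite set set" and H :: "'n::finite set set"
    and r :: nat and \<alpha> :: real
  assumes "r \<ge> 2"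
    and "r_graph r Q"
    and "r_graph r H"
    and "\<alpha> \<ge> 1"
  shows "entropic_density \<alpha> Q H = lagrangian \<alpha> Q H"
proof -
  have \<alpha>: "\<alpha> > 0" using assms(4) by simp
  obtain x where x: "x \<in> alpha_sphere \<alpha>"
    and x_max: "\<And>y. y \<in> alpha_sphere \<alpha> \<Longrightarrow> lagrange_poly Q H y \<le> lagrange_poly Q H x"
    using lagrangian_max_exists[OF assms(4), of Q H] by blast
  have lagr: "lagrangian \<alpha> Q H = lagrange_poly Q H x"
    unfolding lagrangian_def using x x_max by (intro Greatest_equality) auto
  show ?thesis
  proof (cases "Inj Q H = {}")
    case True
    then show ?thesis by (simp add: lagr entropic_density_def lagrange_poly_def)
  next
    case False
    obtain p where p: "random_embedding Q H p"
      and p_max: "\<And>p'. random_embedding Q H p' \<Longrightarrow> entropic_value \<alpha> p' \<le> entropic_value \<alpha> p"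
      using entropic_max_exists[OF False, of \<alpha>] by blast
    have entr: "entropic_density \<alpha> Q H = entropic_value \<alpha> p"
      unfolding entropic_density_def using False p p_max by (auto intro!: Greatest_equality)
    have le: "entropic_value \<alpha> p \<le> lagrange_poly Q H x"
      using entropic_value_le_lagrange_poly[OF p \<alpha>] x_max by fastforce
    \<comment> \<open>Entropic values are powers of 2, so the bound just proved also makes the Lagrangian
      positive, which is what normalising the monomials requires.\<close>
    have "0 < entropic_value \<alpha> p" by (simp add: entropic_value_def)
    with le have "0 < lagrange_poly Q H (\<chi> v. \<bar>x $ v\<bar>)"
      using lagrange_poly_le_abs[of Q H x] by simp
    moreover have "(\<chi> v. \<bar>x $ v\<bar>) \<in> alpha_sphere \<alpha>"
      using x by (simp add: alpha_sphere_def)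
    ultimately obtain p' where "random_embedding Q H p'"
      and "lagrange_poly Q H (\<chi> v. \<bar>x $ v\<bar>) \<le> entropic_value \<alpha> p'"
      using lagrange_poly_le_entropic_value[of "\<chi> v. \<bar>x $ v\<bar>" \<alpha> Q H] \<alpha> by auto
    then have "lagrange_poly Q H x \<le> entropic_value \<alpha> p"
      using lagrange_poly_le_abs[of Q H x] p_max by fastforce
    with le show ?thesis by (simp add: lagr entr)
  qed
qed

end
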